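(* Let $X\subset\mathbb{P}_n$ be an arithmetically Cohen-Macaulay projective subscheme of pure dimension $m\ge1$ and degree $d$. Let $H$ be a hypersurface of $\mathbb{P}_n$ of degree $s$ cutting $X$ properly, and $H_s:=X\cap H$. Let $Y\subset X$ be an ACM hypersurface of $X$ with relative characteristic sequence $(n_i)_{0\le i\le d-1}$, and suppose that $H_s$ and $Y$ are linked in an ACM hypersurface $Y'=Y\cup H_s$ of $X$, with relative characteristic sequence $(n_i')_{0\le i\le d-1}$. Then $n_i'=n_i+s$ for all $i$.
   Context: $k$ is an algebraically closed field of characteristic $0$, $A_n=k[X_0,\dots,X_n]$. A projective subscheme $X\subset\mathbb{P}_n$ is given by its saturated homogeneous ideal $I_X$; $A_X=A_n/I_X$. The union $V\cup V'$ is defined by the ideal $I_V\cap I_{V'}$. $B[a](l)=B(a+l)$ denotes the shift of a graded module. $X$ of dimension $m$ is arithmetically Cohen-Macaulay (ACM) if $A_X$ admits a regular sequence of $m+1$ homogeneous polynomials. A hypersurface $\{h=0\}$ cuts $X$ properly if multiplication by $h$ is injective on $A_X$. Relative characteristic sequence: let $X$ be ACM of pure dimension $m$ and degree $d$, let $Y_0,\dots,Y_m$ be linear forms whose common zero locus does not meet $X$, and $R_m=k[Y_0,\dots,Y_m]$. An ACM hypersurface of $X$ is an ACM closed subscheme $Y\subset X$ of pure dimension $m-1$. The kernel $I_{Y/X}=I_Y/I_X$ of $A_X\to A_Y$ is a graded free $R_m$-module of rank $d$, $I_{Y/X}\simeq\bigoplus_{i=0}^{d-1}R_m[-n_i]$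 with $n_0\le\dots\le n_{d-1}$; $(n_i)$ is the relative characteristic sequence of $Y$ (relative to $X$). Linkage: let $V,V'$ be two subschemes and let $Z$ be defined by $I_Z=I_V\cap I_{V'}$. Multiplication gives a morphism of $A_n$-modules $I_{V'}\to\operatorname{Hom}_{A_n}(I_V,I_Z)$. One says that $V$ and $V'$ are linked in $Z$, and that $V'$ is the residual of $V$ in $Z$, if this morphism is an isomorphism. (Here $V=H_s$, $V'=Y$, and $Y'$ plays the role of $Z$.) *)

theory Defs
  imports
    "HOL-Computational_Algebra.Polynomial"
    "HOL-Library.Poly_Mapping"
    "HOL-Algebra.QuotRing"
    "HOL-Algebra.Module"
    "HOL-Algebra.Generated_Rings"
    "HOL-Algebra.Embedded_Algebras"
begin

section \<open>The graded polynomial ring\<close>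

text \<open>
  The ring \<open>A\<^sub>n = k[X\<^sub>0,\<dots>,X\<^sub>n]\<close> is modelled by finitely supported functions on exponent vectors,
  with convolution as multiplication.  The variables are indexed by a finite type \<open>'v\<close>; as types
  are nonempty, \<open>n + 1 = CARD('v) \<ge> 1\<close> is arbitrary.
\<close>

type_synonym ('v, 'k) mpol = "('v \<Rightarrow>\<^sub>0 nat) \<Rightarrow>\<^sub>0 'k"

definition poly_ring :: "('v::finite, 'k::field) mpol ring" ("\<A>") where
  "poly_ring = \<lparr>carrier = UNIV, mult = (*), one = 1, zero = 0, add = (+)\<rparr>"

lemma poly_ring_cring: "cring (\<A> :: ('v::finite, 'k::field) mpol ring)"
proof (rule cringI)
  show "abelian_group (\<A> :: ('v, 'k) mpol ring)"
  proof (rule abelian_groupI)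
    fix x :: "('v, 'k) mpol"
    show "\<exists>y\<in>carrier \<A>. y \<oplus>\<^bsub>\<A>\<^esub> x = \<zero>\<^bsub>\<A>\<^esub>"
      by (rule bexI[of _ "- x"]) (simp_all add: poly_ring_def)
  qed (simp_all add: poly_ring_def algebra_simps)
  show "Group.comm_monoid (\<A> :: ('v, 'k) mpol ring)"
    by (rule comm_monoidI) (simp_all add: poly_ring_def algebra_simps)
qed (simp add: poly_ring_def algebra_simps)

definition const_mpol :: "'k::field \<Rightarrow> ('v::finite, 'k) mpol" where
  "const_mpol c = Poly_Mapping.single 0 c"

definition monomial_degree :: "('v::finite \<Rightarrow>\<^sub>0 nat) \<Rightarrow> int" where
  "monomial_degree t = (\<Sum>v\<in>UNIV. int (Poly_Mapping.lookup t v))"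

text \<open>Degrees are integers, so that shifts make sense; \<open>0\<close> is homogeneous of every degree.\<close>

definition homogeneous :: "int \<Rightarrow> ('v::finite, 'k::field) mpol \<Rightarrow> bool" where
  "homogeneous l f \<longleftrightarrow> (\<forall>t\<in>Poly_Mapping.keys f. monomial_degree t = l)"

definition hom_part :: "int \<Rightarrow> ('v::finite, 'k::field) mpol \<Rightarrow> ('v, 'k) mpol" where
  "hom_part l f =
    (\<Sum>t\<in>{t\<in>Poly_Mapping.keys f. monomial_degree t = l}.
     Poly_Mapping.single t (Poly_Mapping.lookup f t))"

definition homogeneous_ideal :: "('v::finite, 'k::field) mpol set \<Rightarrow> bool" where
  "homogeneous_ideal I \<longleftrightarrow> ideal I \<A> \<and> (\<forall>f\<in>I. \<forall>l. hom_part l f \<in> I)"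

definition irrelevant_ideal :: "('v::finite, 'k::field) mpol set" where
  "irrelevant_ideal = {f. Poly_Mapping.lookup f 0 = 0}"


section \<open>Projective subschemes, given by saturated homogeneous ideals\<close>

text \<open>Since \<open>(X\<^sub>0,\<dots>,X\<^sub>n)\<^sup>N\<close> is generated by the forms of degree \<open>N\<close>, this is
  \<open>\<Union>N. (I : (X\<^sub>0,\<dots>,X\<^sub>n)\<^sup>N)\<close>.\<close>

definition saturation :: "('v::finite, 'k::field) mpol set \<Rightarrow> ('v, 'k) mpol set" where
  "saturation I = {f. \<exists>N::nat. \<forall>g. homogeneous (int N) g \<longrightarrow> g * f \<in> I}"

definition projective_subscheme :: "('v::finite, 'k::field) mpol set \<Rightarrow> bool" where
  "projective_subscheme I \<longleftrightarrow> homogeneous_ideal I \<and> saturation I = I"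

definition scheme_inter ::
    "('v::finite, 'k::field) mpol set \<Rightarrow> ('v, 'k) mpol set \<Rightarrow> ('v, 'k) mpol set" where
  "scheme_inter I J = saturation (I <+>\<^bsub>\<A>\<^esub> J)"

abbreviation coord_ring ::
    "('v::finite, 'k::field) mpol set \<Rightarrow> ('v, 'k) mpol set ring" where
  "coord_ring I \<equiv> \<A> Quot I"

abbreviation residue_class ::
    "('v::finite, 'k::field) mpol set \<Rightarrow> ('v, 'k) mpol \<Rightarrow> ('v, 'k) mpol set" where
  "residue_class I f \<equiv> I +>\<^bsub>\<A>\<^esub> f"

text \<open>The (scheme-theoretic) points of the subscheme \<open>Proj (A\<^sub>n / I)\<close> of projective space.\<close>

definition proj_points :: "('v::finite, 'k::field) mpol set \<Rightarrow> ('v, 'k) mpol set set" where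
  "proj_points I = {P. primeideal P \<A> \<and> homogeneous_ideal P \<and> I \<subseteq> P \<and>
                       \<not> irrelevant_ideal \<subseteq> P}"

text \<open>The points of the closed subset \<open>Proj (A\<^sub>n / I)\<close> correspond, via closures, to its irreducible
  closed subsets, so its topological dimension is measured by chains of points.  In particular
  the empty subscheme has no dimension.\<close>

definition has_dimension :: "('v::finite, 'k::field) mpol set \<Rightarrow> nat \<Rightarrow> bool" where
  "has_dimension I m \<longleftrightarrow>
     (\<exists>Ps. set Ps \<subseteq> proj_points I \<and> sorted_wrt (\<subset>) Ps \<and> length Ps = m + 1) \<and>
     (\<forall>Ps. set Ps \<subseteq> proj_points I \<and> sorted_wrt (\<subset>) Ps \<longrightarrow> length Ps \<le> m + 1)"

text \<open>Irreducible components correspond to minimal points (generic points).\<close>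

definition pure_dimension :: "('v::finite, 'k::field) mpol set \<Rightarrow> nat \<Rightarrow> bool" where
  "pure_dimension I m \<longleftrightarrow>
     proj_points I \<noteq> {} \<and>
     (\<forall>P\<in>proj_points I. (\<forall>Q\<in>proj_points I. \<not> Q \<subset> P) \<longrightarrow> has_dimension P m)"

definition coord_ring_component ::
    "('v::finite, 'k::field) mpol set \<Rightarrow> int \<Rightarrow> ('v, 'k) mpol set set" where
  "coord_ring_component I l = residue_class I ` {f. homogeneous l f}"

text \<open>
  The degree is \<open>m!\<close> times the leading coefficient of the Hilbert polynomial, where \<open>m\<close> is the
  dimension.  The inductive predicate \<open>ring.dimension R r K E\<close> says that \<open>E \<subseteq> R\<close> has dimension \<open>r\<close>
  over the subfield \<open>K\<close> of \<open>R\<close>; here \<open>K\<close> is the copy of the ground field in the coordinate ring.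
\<close>

definition hilbert_polynomial :: "('v::finite, 'k::field) mpol set \<Rightarrow> rat poly \<Rightarrow> bool" where
  "hilbert_polynomial I p \<longleftrightarrow>
     (\<exists>l\<^sub>0. \<forall>l\<ge>l\<^sub>0. \<exists>r. ring.dimension (coord_ring I) r (residue_class I ` range const_mpol)
                        (coord_ring_component I (int l)) \<and> of_nat r = poly p (of_nat l))"

definition has_degree :: "('v::finite, 'k::field) mpol set \<Rightarrow> nat \<Rightarrow> bool" where
  "has_degree I d \<longleftrightarrow>
     (\<exists>m p. has_dimension I m \<and> hilbert_polynomial I p \<and> degree p = m \<and>
            of_nat d = fact m * lead_coeff p)"


section \<open>Arithmetically Cohen--Macaulay subschemes\<close>

definition regular_sequence :: "('a, 'b) ring_scheme \<Rightarrow> 'a list \<Rightarrow> bool" where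
  "regular_sequence R xs \<longleftrightarrow>
     set xs \<subseteq> carrier R \<and>
     (\<forall>i<length xs. \<forall>a\<in>carrier R.
        xs ! i \<otimes>\<^bsub>R\<^esub> a \<in> Idl\<^bsub>R\<^esub> (set (take i xs)) \<longrightarrow> a \<in> Idl\<^bsub>R\<^esub> (set (take i xs))) \<and>
     Idl\<^bsub>R\<^esub> (set xs) \<noteq> carrier R"

definition ACM :: "('v::finite, 'k::field) mpol set \<Rightarrow> nat \<Rightarrow> bool" where
  "ACM I m \<longleftrightarrow>
     has_dimension I m \<and>
     (\<exists>fs. length fs = m + 1 \<and> (\<forall>f\<in>set fs. \<exists>l. homogeneous l f) \<and>
           regular_sequence (coord_ring I) (map (residue_class I) fs))"

text \<open>Here \<open>IX\<close> is an ideal of pure dimension \<open>m \<ge> 1\<close>.\<close>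

definition ACM_hypersurface ::
    "('v::finite, 'k::field) mpol set \<Rightarrow> nat \<Rightarrow> ('v, 'k) mpol set \<Rightarrow> bool" where
  "ACM_hypersurface IX m IY \<longleftrightarrow>
     projective_subscheme IY \<and> IX \<subseteq> IY \<and> ACM IY (m - 1) \<and> pure_dimension IY (m - 1)"

definition hypersurface_form :: "('v::finite, 'k::field) mpol \<Rightarrow> nat \<Rightarrow> bool" where
  "hypersurface_form h s \<longleftrightarrow> h \<noteq> 0 \<and> homogeneous (int s) h"

definition cuts_properly ::
    "('v::finite, 'k::field) mpol \<Rightarrow> ('v, 'k) mpol set \<Rightarrow> bool" where
  "cuts_properly h I \<longleftrightarrow>
     inj_on (\<lambda>x. residue_class I h \<otimes>\<^bsub>coord_ring I\<^esub> x) (carrier (coord_ring I))"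


section \<open>Graded modules\<close>

text \<open>As usual for \<^typ>\<open>('a, 'b) module\<close>, the ring fields \<open>mult\<close> and \<open>one\<close> play no role in modules.\<close>

record ('a, 'b) graded_module = "('a, 'b) module" +
  component :: "int \<Rightarrow> 'b set"

definition shift :: "('a, 'b) graded_module \<Rightarrow> int \<Rightarrow> ('a, 'b) graded_module" where
  "shift M a = M\<lparr>component := \<lambda>l. component M (a + l)\<rparr>"

definition direct_sum ::
    "nat \<Rightarrow> (nat \<Rightarrow> ('a, 'b) graded_module) \<Rightarrow> ('a, nat \<Rightarrow> 'b) graded_module" where
  "direct_sum d M =
     \<lparr>carrier = (\<Pi>\<^sub>E i\<in>{..<d}. carrier (M i)),
      mult = undefined,
      one = undefined,
      zero = (\<lambda>i\<in>{..<d}. \<zero>\<^bsub>M i\<^esub>),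
      add = (\<lambda>u v. \<lambda>i\<in>{..<d}. u i \<oplus>\<^bsub>M i\<^esub> v i),
      smult = (\<lambda>r u. \<lambda>i\<in>{..<d}. r \<odot>\<^bsub>M i\<^esub> u i),
      component = (\<lambda>l. \<Pi>\<^sub>E i\<in>{..<d}. component (M i) l)\<rparr>"

definition graded_iso ::
    "('a, 'r) ring_scheme \<Rightarrow> ('a, 'b) graded_module \<Rightarrow> ('a, 'c) graded_module \<Rightarrow> bool" where
  "graded_iso R M N \<longleftrightarrow>
     (\<exists>\<phi>. bij_betw \<phi> (carrier M) (carrier N) \<and>
          (\<forall>x\<in>carrier M. \<forall>y\<in>carrier M. \<phi> (x \<oplus>\<^bsub>M\<^esub> y) = \<phi> x \<oplus>\<^bsub>N\<^esub> \<phi> y) \<and>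
          (\<forall>r\<in>carrier R. \<forall>x\<in>carrier M. \<phi> (r \<odot>\<^bsub>M\<^esub> x) = r \<odot>\<^bsub>N\<^esub> \<phi> x) \<and>
          (\<forall>l. \<phi> ` component M l = component N l))"


section \<open>Relative characteristic sequences\<close>

definition linear_system_of_parameters ::
    "('v::finite, 'k::field) mpol set \<Rightarrow> nat \<Rightarrow> (nat \<Rightarrow> ('v, 'k) mpol) \<Rightarrow> bool" where
  "linear_system_of_parameters I m L \<longleftrightarrow>
     (\<forall>i\<le>m. homogeneous 1 (L i)) \<and> {P\<in>proj_points I. \<forall>i\<le>m. L i \<in> P} = {}"

text \<open>\<open>R\<^sub>m = k[L\<^sub>0,\<dots>,L\<^sub>m]\<close>, as a graded subring of \<open>A\<^sub>n\<close>.\<close>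

definition param_ring ::
    "nat \<Rightarrow> (nat \<Rightarrow> ('v::finite, 'k::field) mpol) \<Rightarrow> ('v, 'k) mpol ring" where
  "param_ring m L = \<A>\<lparr>carrier := generate_ring \<A> (range const_mpol \<union> L ` {..m})\<rparr>"

definition param_ring_module ::
    "nat \<Rightarrow> (nat \<Rightarrow> ('v::finite, 'k::field) mpol) \<Rightarrow>
     (('v, 'k) mpol, ('v, 'k) mpol) graded_module" where
  "param_ring_module m L =
     \<lparr>carrier = carrier (param_ring m L),
      mult = (*), one = 1, zero = 0, add = (+), smult = (*),
      component = (\<lambda>l. {f\<in>carrier (param_ring m L). homogeneous l f})\<rparr>"

text \<open>The kernel \<open>I\<^sub>Y / I\<^sub>X\<close> of \<open>A\<^sub>X \<rightarrow> A\<^sub>Y\<close>, with scalars acting through \<open>A\<^sub>n \<rightarrow> A\<^sub>X\<close>.\<close>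

definition relative_ideal ::
    "('v::finite, 'k::field) mpol set \<Rightarrow> ('v, 'k) mpol set \<Rightarrow>
     (('v, 'k) mpol, ('v, 'k) mpol set) graded_module" where
  "relative_ideal IX IY =
     \<lparr>carrier = residue_class IX ` IY,
      mult = mult (coord_ring IX),
      one = undefined,
      zero = \<zero>\<^bsub>coord_ring IX\<^esub>,
      add = add (coord_ring IX),
      smult = (\<lambda>r x. residue_class IX r \<otimes>\<^bsub>coord_ring IX\<^esub> x),
      component = (\<lambda>l. residue_class IX ` {f\<in>IY. homogeneous l f})\<rparr>"

definition relative_char_seq ::
    "nat \<Rightarrow> (nat \<Rightarrow> ('v::finite, 'k::field) mpol) \<Rightarrow> ('v, 'k) mpol set \<Rightarrow> ('v, 'k) mpol set \<Rightarrow>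
     nat \<Rightarrow> (nat \<Rightarrow> int) \<Rightarrow> bool" where
  "relative_char_seq m L IX IY d n \<longleftrightarrow>
     mono_on {..<d} n \<and>
     graded_iso (param_ring m L) (relative_ideal IX IY)
       (direct_sum d (\<lambda>i. shift (param_ring_module m L) (- n i)))"


section \<open>Linkage\<close>

definition ideal_Hom ::
    "('v::finite, 'k::field) mpol set \<Rightarrow> ('v, 'k) mpol set \<Rightarrow>
     (('v, 'k) mpol \<Rightarrow> ('v, 'k) mpol) set" where
  "ideal_Hom I J =
     {\<phi> \<in> I \<rightarrow>\<^sub>E J. (\<forall>f\<in>I. \<forall>g\<in>I. \<phi> (f + g) = \<phi> f + \<phi> g) \<and> (\<forall>a. \<forall>f\<in>I. \<phi> (a * f) = a * \<phi> f)}"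

text \<open>\<open>linked V V' Z\<close>: the subschemes with ideals \<open>V\<close> and \<open>V'\<close> are linked in their union, the
  subscheme with ideal \<open>Z\<close>, the subscheme of \<open>V'\<close> being the residual.  The multiplication map is
  always a module morphism, so it is an isomorphism iff it is bijective.\<close>

definition linked ::
    "('v::finite, 'k::field) mpol set \<Rightarrow> ('v, 'k) mpol set \<Rightarrow> ('v, 'k) mpol set \<Rightarrow> bool" where
  "linked V V' Z \<longleftrightarrow>
     Z = V \<inter> V' \<and> bij_betw (\<lambda>g. \<lambda>f\<in>V. g * f) V' (ideal_Hom V Z)"

end

theory Submission
  imports Defs
begin

text \<open>
  Since \<open>A\<^sub>X\<close> has depth at least 2, the ideal \<open>I\<^sub>X + (h)\<close> is saturated and hence equals the ideal
  of \<open>H\<^sub>s\<close>.  If \<open>x + h a\<close> lies in \<open>I\<^bsub>Y'\<^esub>\<close> with \<open>x \<in> I\<^sub>X\<close>, then multiplication by \<open>a\<close> maps the ideal of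
  \<open>H\<^sub>s\<close> into \<open>I\<^bsub>Y'\<^esub>\<close>; by linkage \<open>a \<in> I\<^sub>Y\<close>.  So \<open>I\<^bsub>Y'\<^esub> = h I\<^sub>Y + I\<^sub>X\<close>, and multiplication by \<open>h\<close> is an
  isomorphism \<open>I\<^bsub>Y/X\<^esub> \<simeq> I\<^bsub>Y'/X\<^esub>[s]\<close>.  The claim is then the uniqueness of the degrees of the generators
  of a graded free module.
\<close>

subsection \<open>Homogeneous polynomials\<close>

lemma poly_ring_simps [simp]:
  "carrier \<A> = UNIV" "mult \<A> = (*)" "one \<A> = 1" "zero \<A> = 0" "add \<A> = (+)"
  by (simp_all add: poly_ring_def)

lemma monomial_degree_zero [simp]: "monomial_degree 0 = 0"
  by (simp add: monomial_degree_def)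

lemma monomial_degree_add: "monomial_degree (s + t) = monomial_degree s + monomial_degree t"
  by (simp add: monomial_degree_def lookup_add sum.distrib)

lemma monomial_degree_single [simp]: "monomial_degree (Poly_Mapping.single v k) = int k"
proof -
  have "monomial_degree (Poly_Mapping.single v k) = (\<Sum>w\<in>UNIV. if v = w then int k else 0)"
    unfolding monomial_degree_def by (intro sum.cong) (auto simp: lookup_single when_def)
  then show ?thesis by simp
qed

lemma monomial_degree_nonneg: "monomial_degree t \<ge> 0"
  by (simp add: monomial_degree_def sum_nonneg)

lemma monomial_degree_eq_0_iff: "monomial_degree t = 0 \<longleftrightarrow> t = 0"
proof
  assume "monomial_degree t = 0"
  then have "\<forall>v. Poly_Mapping.lookup t v = 0"
    unfolding monomial_degree_def by (subst (asm) sum_nonneg_eq_0_iff) auto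
  then show "t = 0" by (intro poly_mapping_eqI) simp
qed simp

lemma monomial_split_degree:
  assumes "int N \<le> monomial_degree t"
  shows "\<exists>u w. t = u + w \<and> monomial_degree u = int N"
  using assms
proof (induction N)
  case 0
  show ?case by (rule exI[of _ 0]) simp
next
  case (Suc N)
  then obtain u w where uw: "t = u + w" "monomial_degree u = int N" by auto
  with Suc.prems have "w \<noteq> 0" by auto
  then obtain v where v: "Poly_Mapping.lookup w v \<noteq> 0"
    by (metis poly_mapping_eqI lookup_zero)
  have "w = Poly_Mapping.single v 1 + (w - Poly_Mapping.single v 1)"
    using v by (intro poly_mapping_eqI) (auto simp: lookup_add lookup_minus lookup_single when_def)
  then have "t = (u + Poly_Mapping.single v 1) + (w - Poly_Mapping.single v 1)"
    using uw(1) by (metis add.assoc)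
  moreover have "monomial_degree (u + Poly_Mapping.single v 1) = int (Suc N)"
    by (simp add: monomial_degree_add uw(2))
  ultimately show ?case by blast
qed

lemma sum_monomials:
  "(\<Sum>t\<in>Poly_Mapping.keys f. Poly_Mapping.single t (Poly_Mapping.lookup f t)) = f"
  by (intro poly_mapping_eqI)
    (simp add: lookup_sum lookup_single when_def in_keys_iff)

lemma homogeneous_iff: "homogeneous l f \<longleftrightarrow> (\<forall>t. Poly_Mapping.lookup f t \<noteq> 0 \<longrightarrow> monomial_degree t = l)"
  by (auto simp: homogeneous_def in_keys_iff)

lemma homogeneous_zero [simp]: "homogeneous l 0"
  by (simp add: homogeneous_iff)

lemma homogeneous_one: "homogeneous 0 1"
  by (simp add: homogeneous_def)

lemma homogeneous_mult:
  assumes "homogeneous a f" "homogeneous b g"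
  shows "homogeneous (a + b) (f * g)"
  using keys_mult[of f g] assms by (fastforce simp: homogeneous_def monomial_degree_add)

lemma homogeneous_power:
  assumes "homogeneous a f"
  shows "homogeneous (int N * a) (f ^ N)"
proof (induction N)
  case (Suc N)
  then show ?case using homogeneous_mult[OF assms Suc] by (simp add: algebra_simps)
qed (simp add: homogeneous_one)

lemma homogeneous_nonpos_const:
  assumes "homogeneous l f" "l \<le> 0"
  shows "f = const_mpol (Poly_Mapping.lookup f 0)"
proof (rule poly_mapping_eqI)
  fix t
  have "Poly_Mapping.lookup f t = 0" if "t \<noteq> 0"
    using assms that monomial_degree_nonneg[of t] monomial_degree_eq_0_iff[of t]
    by (force simp: homogeneous_iff)
  then show "Poly_Mapping.lookup f t = Poly_Mapping.lookup (const_mpol (Poly_Mapping.lookup f 0)) t"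
    by (simp add: const_mpol_def lookup_single when_def)
qed

lemma lookup_hom_part:
  "Poly_Mapping.lookup (hom_part l f) t = (if monomial_degree t = l then Poly_Mapping.lookup f t else 0)"
  by (simp add: hom_part_def lookup_sum lookup_single when_def in_keys_iff)

lemma homogeneous_hom_part: "homogeneous l (hom_part l f)"
  by (simp add: homogeneous_iff lookup_hom_part)

lemma hom_part_homogeneous: "homogeneous l f \<Longrightarrow> hom_part l f = f"
  by (intro poly_mapping_eqI) (auto simp: homogeneous_iff lookup_hom_part)

lemma hom_part_add: "hom_part l (f + g) = hom_part l f + hom_part l g"
  by (intro poly_mapping_eqI) (simp add: lookup_hom_part lookup_add)

lemma hom_part_homogeneous_mult:
  assumes "homogeneous a h"
  shows "hom_part (l + a) (h * f) = h * hom_part l f"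
proof -
  define r where "r = f - hom_part l f"
  have r: "monomial_degree t \<noteq> l" if "t \<in> Poly_Mapping.keys r" for t
    using that by (auto simp: r_def in_keys_iff lookup_minus lookup_hom_part split: if_splits)
  have "hom_part (l + a) (h * r) = 0"
  proof (rule poly_mapping_eqI)
    fix t
    have "monomial_degree t \<noteq> l + a" if "t \<in> Poly_Mapping.keys (h * r)"
      using that keys_mult[of h r] r assms by (fastforce simp: homogeneous_def monomial_degree_add)
    then show "Poly_Mapping.lookup (hom_part (l + a) (h * r)) t = Poly_Mapping.lookup 0 t"
      by (auto simp: lookup_hom_part in_keys_iff)
  qed
  moreover have "homogeneous (l + a) (h * hom_part l f)"
    using homogeneous_mult[OF assms homogeneous_hom_part[of l f]] by (simp add: add.commute)
  moreover have "h * f = h * hom_part l f + h * r" by (simp add: r_def algebra_simps)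
  ultimately show ?thesis by (metis hom_part_add hom_part_homogeneous add.right_neutral)
qed

lemma lookup_mult_zero:
  fixes f g :: "('v::finite, 'k::field) mpol"
  shows "Poly_Mapping.lookup (f * g) 0 = Poly_Mapping.lookup f 0 * Poly_Mapping.lookup g 0"
proof -
  define c d :: "('v, 'k) mpol" where "c = const_mpol (Poly_Mapping.lookup f 0)" and "d = const_mpol (Poly_Mapping.lookup g 0)"
  have no_const: "Poly_Mapping.lookup (p * q) 0 = 0"
    if "Poly_Mapping.lookup p 0 = 0" for p q :: "('v, 'k) mpol"
  proof (rule ccontr)
    assume "\<not> ?thesis"
    then have "0 \<in> Poly_Mapping.keys (p * q)" by (simp add: in_keys_iff)
    from subsetD[OF keys_mult this] obtain s t where st: "s \<in> Poly_Mapping.keys p" "0 = s + t"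
      by blast
    have "monomial_degree s + monomial_degree t = 0"
      by (simp flip: monomial_degree_add st(2))
    then have "s = 0"
      using monomial_degree_nonneg[of s] monomial_degree_nonneg[of t] monomial_degree_eq_0_iff[of s] by simp
    then show False using st that by (simp add: in_keys_iff)
  qed
  have "f * g = c * d + ((f - c) * g + (g - d) * c)" by (simp add: algebra_simps)
  moreover have "Poly_Mapping.lookup ((f - c) * g) 0 = 0" "Poly_Mapping.lookup ((g - d) * c) 0 = 0"
    by (rule no_const, simp add: c_def d_def const_mpol_def lookup_minus)+
  ultimately have "Poly_Mapping.lookup (f * g) 0 = Poly_Mapping.lookup (c * d) 0"
    by (simp add: lookup_add)
  then show ?thesis by (simp add: c_def d_def const_mpol_def mult_single)
qed

subsection \<open>Ideals and cosets of the polynomial ring\<close>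

context
  fixes I :: "('v::finite, 'k::field) mpol set"
  assumes I: "ideal I \<A>"
begin

lemma ideal_zero: "0 \<in> I"
  using additive_subgroup.zero_closed[OF ideal.axioms(1)[OF I]] by simp

lemma ideal_add: "f \<in> I \<Longrightarrow> g \<in> I \<Longrightarrow> f + g \<in> I"
  using additive_subgroup.a_closed[OF ideal.axioms(1)[OF I]] by simp

lemma ideal_mult: "f \<in> I \<Longrightarrow> a * f \<in> I"
  using ideal.I_l_closed[OF I] by simp

lemma ideal_diff: "f \<in> I \<Longrightarrow> g \<in> I \<Longrightarrow> f - g \<in> I"
  using ideal_add[of f "(-1) * g"] ideal_mult[of g "-1"] by simp

lemma ideal_sum: "(\<And>x. x \<in> S \<Longrightarrow> F x \<in> I) \<Longrightarrow> sum F S \<in> I"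
  by (induction S rule: infinite_finite_induct) (auto intro: ideal_zero ideal_add)

lemma residue_class_eq_iff: "residue_class I f = residue_class I g \<longleftrightarrow> f - g \<in> I"
proof -
  have *: "residue_class I f = {i + f |i. i \<in> I}" for f
    by (auto simp: a_r_coset_def')
  show ?thesis
  proof
    assume "residue_class I f = residue_class I g"
    moreover have "f \<in> residue_class I f"
      unfolding * using ideal_zero by force
    ultimately show "f - g \<in> I" unfolding * by auto
  next
    assume d: "f - g \<in> I"
    show "residue_class I f = residue_class I g"
    proof (rule Set.set_eqI)
      fix x
      have "x - f \<in> I \<longleftrightarrow> x - g \<in> I"
        using ideal_add[OF _ d, of "x - f"] ideal_diff[OF _ d, of "x - g"] by (auto simp: algebra_simps)
      moreover have "x \<in> residue_class I p \<longleftrightarrow> x - p \<in> I" for p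
        unfolding * by (auto intro!: exI[of _ "x - p"])
      ultimately show "x \<in> residue_class I f \<longleftrightarrow> x \<in> residue_class I g" by simp
    qed
  qed
qed

lemma coord_ring_carrier: "carrier (coord_ring I) = range (residue_class I)"
  by (auto simp: FactRing_def A_RCOSETS_def')

lemma coord_ring_mult:
  "residue_class I f \<otimes>\<^bsub>coord_ring I\<^esub> residue_class I g = residue_class I (f * g)"
  using ideal.rcoset_mult_add[OF I, of f g] by (simp add: FactRing_def)

lemma coord_ring_add:
  "residue_class I f \<oplus>\<^bsub>coord_ring I\<^esub> residue_class I g = residue_class I (f + g)"
  using abelian_subgroup.a_rcos_sum[OF abelian_subgroupI3[OF ideal.axioms(1)[OF I]], of f g]
    poly_ring_cring cring.axioms(1) ring.is_abelian_group
  by (simp add: FactRing_def, blast)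

lemma coord_ring_zero: "\<zero>\<^bsub>coord_ring I\<^esub> = residue_class I 0"
  using abelian_group.a_coset_add_zero[OF ring.is_abelian_group[OF cring.axioms(1)[OF poly_ring_cring]], of I]
  by (simp add: FactRing_def)

lemma coord_ring_one: "\<one>\<^bsub>coord_ring I\<^esub> = residue_class I 1"
  by (simp add: FactRing_def)

lemma coord_ring_cring: "cring (coord_ring I)"
  using ideal.quotient_is_cring[OF I poly_ring_cring] .

lemma residue_class_genideal_empty: "residue_class I f \<in> Idl\<^bsub>coord_ring I\<^esub> {} \<longleftrightarrow> f \<in> I"
proof -
  interpret cring "coord_ring I" by (rule coord_ring_cring)
  have "Idl\<^bsub>coord_ring I\<^esub> {} = {\<zero>\<^bsub>coord_ring I\<^esub>}"
    using genideal_minimal[OF zeroideal, of "{}"]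
      additive_subgroup.zero_closed[OF ideal.axioms(1)[OF genideal_ideal[of "{}"]]] by auto
  then show ?thesis by (simp add: coord_ring_zero residue_class_eq_iff)
qed

lemma residue_class_genideal_single:
  "residue_class I f \<in> Idl\<^bsub>coord_ring I\<^esub> {residue_class I g} \<longleftrightarrow> (\<exists>a. f - g * a \<in> I)"
proof -
  interpret cring "coord_ring I" by (rule coord_ring_cring)
  have "Idl\<^bsub>coord_ring I\<^esub> {residue_class I g} = range (\<lambda>a. residue_class I (a * g))"
    by (subst cgenideal_eq_genideal[symmetric])
      (force simp: cgenideal_def coord_ring_carrier coord_ring_mult)+
  then show ?thesis by (auto simp: residue_class_eq_iff mult.commute image_iff)
qed

lemma cuts_properly_iff: "cuts_properly h I \<longleftrightarrow> (\<forall>a. h * a \<in> I \<longrightarrow> a \<in> I)"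
proof
  assume c: "cuts_properly h I"
  show "\<forall>a. h * a \<in> I \<longrightarrow> a \<in> I"
  proof (intro allI impI)
    fix a assume "h * a \<in> I"
    then have "residue_class I h \<otimes>\<^bsub>coord_ring I\<^esub> residue_class I a =
        residue_class I h \<otimes>\<^bsub>coord_ring I\<^esub> residue_class I 0"
      by (simp add: coord_ring_mult residue_class_eq_iff)
    with c have "residue_class I a = residue_class I 0"
      unfolding cuts_properly_def coord_ring_carrier by (blast dest: inj_onD)
    then show "a \<in> I" by (simp add: residue_class_eq_iff)
  qed
next
  assume h: "\<forall>a. h * a \<in> I \<longrightarrow> a \<in> I"
  show "cuts_properly h I"
    unfolding cuts_properly_def coord_ring_carrier
  proof (intro inj_onI, elim rangeE)
    fix x y a b
    assume xy: "x = residue_class I a" "y = residue_class I b"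
      and "residue_class I h \<otimes>\<^bsub>coord_ring I\<^esub> x = residue_class I h \<otimes>\<^bsub>coord_ring I\<^esub> y"
    then have "h * (a - b) \<in> I"
      by (simp add: coord_ring_mult residue_class_eq_iff right_diff_distrib)
    then show "x = y" using h by (simp add: xy residue_class_eq_iff)
  qed
qed

lemma homogeneous_mult_in_ideal:
  assumes N: "\<And>g. homogeneous (int N) g \<Longrightarrow> g * f \<in> I" and "homogeneous l g" "int N \<le> l"
  shows "g * f \<in> I"
proof -
  have "Poly_Mapping.single t c * f \<in> I" if "t \<in> Poly_Mapping.keys g" for t c
  proof -
    have "int N \<le> monomial_degree t" using that assms by (auto simp: homogeneous_def)
    from monomial_split_degree[OF this] obtain u w where uw: "t = u + w" "monomial_degree u = int N"
      by blast
    have "homogeneous (int N) (Poly_Mapping.single u (1::'k))" by (simp add: homogeneous_def uw)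
    from ideal_mult[OF N[OF this], of "Poly_Mapping.single w c"]
    show ?thesis unfolding uw(1) by (simp add: mult.assoc[symmetric] mult_single add.commute)
  qed
  then have "(\<Sum>t\<in>Poly_Mapping.keys g. Poly_Mapping.single t (Poly_Mapping.lookup g t) * f) \<in> I"
    by (rule ideal_sum)
  then show ?thesis by (simp add: sum_distrib_right[symmetric] sum_monomials)
qed

end

subsection \<open>Saturation of a proper hypersurface section\<close>

lemma regular_sequence_power_left:
  fixes I :: "('v::finite, 'k::field) mpol set"
  assumes I: "ideal I \<A>"
    and p: "\<And>a. p * a \<in> I \<Longrightarrow> a \<in> I"
    and q: "\<And>a b. q * a - p * b \<in> I \<Longrightarrow> \<exists>c. a - p * c \<in> I"
  shows "q * a - p ^ N * b \<in> I \<Longrightarrow> \<exists>c. a - p ^ N * c \<in> I"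
proof (induction N arbitrary: a b)
  case 0
  show ?case by (rule exI[of _ a]) (simp add: ideal_zero[OF I])
next
  case (Suc N)
  then obtain c where c: "a - p * c \<in> I" using q[of a "p ^ N * b"] by (auto simp: mult.assoc)
  have "p * (q * c - p ^ N * b) = (q * a - p ^ Suc N * b) - q * (a - p * c)"
    by (simp add: algebra_simps)
  then have "p * (q * c - p ^ N * b) \<in> I"
    using ideal_diff[OF I Suc.prems ideal_mult[OF I c, of q]] by simp
  from Suc.IH[OF p[OF this]] obtain e where e: "c - p ^ N * e \<in> I" by blast
  have "a - p ^ Suc N * e = (a - p * c) + p * (c - p ^ N * e)" by (simp add: algebra_simps)
  then show ?case using ideal_add[OF I c ideal_mult[OF I e, of p]] by metis
qed

lemma regular_sequence_power_right:
  fixes I :: "('v::finite, 'k::field) mpol set"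
  assumes q: "\<And>a b. q * a - p * b \<in> I \<Longrightarrow> \<exists>c. a - p * c \<in> I"
    and I: "ideal I \<A>"
  shows "q ^ M * a - p * b \<in> I \<Longrightarrow> \<exists>c. a - p * c \<in> I"
proof (induction M arbitrary: a b)
  case 0
  then show ?case by auto
next
  case (Suc M)
  then obtain c where "q ^ M * a - p * c \<in> I" using q[of "q ^ M * a" b] by (auto simp: mult.assoc)
  then show ?case by (rule Suc.IH)
qed

lemma ACM_regular_pair:
  assumes I: "ideal I \<A>" and "ACM I m" "m \<ge> 1"
  obtains p q k l where "homogeneous k p" "homogeneous l q" "k \<ge> 1" "l \<ge> 1"
    "\<And>a. p * a \<in> I \<Longrightarrow> a \<in> I" "\<And>a b. q * a - p * b \<in> I \<Longrightarrow> \<exists>c. a - p * c \<in> I"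
proof -
  let ?Q = "coord_ring I"
  interpret Q: cring ?Q by (rule coord_ring_cring[OF I])
  obtain fs where fs: "length fs = m + 1" "\<forall>f\<in>set fs. \<exists>l. homogeneous l f"
    and reg: "regular_sequence ?Q (map (residue_class I) fs)"
    using \<open>ACM I m\<close> unfolding ACM_def by blast
  obtain p q gs where pq: "fs = p # q # gs"
    using fs(1) \<open>m \<ge> 1\<close> by (cases fs; cases "tl fs") auto
  let ?J = "Idl\<^bsub>?Q\<^esub> (set (map (residue_class I) fs))"
  have sub: "set (map (residue_class I) fs) \<subseteq> carrier ?Q"
    and reg': "\<And>i a. i < length fs \<Longrightarrow> a \<in> carrier ?Q \<Longrightarrow>
        map (residue_class I) fs ! i \<otimes>\<^bsub>?Q\<^esub> a \<in> Idl\<^bsub>?Q\<^esub> (set (take i (map (residue_class I) fs))) \<Longrightarrow>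
        a \<in> Idl\<^bsub>?Q\<^esub> (set (take i (map (residue_class I) fs)))"
    and ne: "?J \<noteq> carrier ?Q"
    using reg unfolding regular_sequence_def by auto
  interpret J: ideal ?J ?Q by (rule Q.genideal_ideal[OF sub])
  have mem: "residue_class I f \<in> ?J" if "f \<in> set fs" for f
    using Q.genideal_self[OF sub] that by auto
  have no_unit: "\<not> a * f - 1 \<in> I" if "f \<in> set fs" for f a
  proof
    assume "a * f - 1 \<in> I"
    then have "residue_class I a \<otimes>\<^bsub>?Q\<^esub> residue_class I f = \<one>\<^bsub>?Q\<^esub>"
      by (simp add: coord_ring_mult[OF I] coord_ring_one[OF I] residue_class_eq_iff[OF I])
    moreover have "residue_class I a \<otimes>\<^bsub>?Q\<^esub> residue_class I f \<in> ?J"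
      using mem[OF that] by (intro J.I_l_closed) (auto simp: coord_ring_carrier[OF I])
    ultimately show False using J.one_imp_carrier ne by simp
  qed
  have p: "a \<in> I" if "p * a \<in> I" for a
    using reg'[of 0 "residue_class I a"] that
    by (simp add: pq coord_ring_mult[OF I] residue_class_genideal_empty[OF I] coord_ring_carrier[OF I])
  have q: "\<exists>c. a - p * c \<in> I" if "q * a - p * b \<in> I" for a b
    using reg'[of 1 "residue_class I a"] that
    by (auto simp: pq coord_ring_mult[OF I] residue_class_genideal_single[OF I] coord_ring_carrier[OF I])
  have pos: "l \<ge> 1" if f: "homogeneous l f" and that: "f \<in> set fs" "f \<noteq> 0" for l f
  proof (rule ccontr)
    assume "\<not> l \<ge> 1"
    then have "l \<le> 0" by simp
    then obtain c where c: "f = const_mpol c" using homogeneous_nonpos_const[OF f] by blast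
    with that(2) have "c \<noteq> 0" by (auto simp: const_mpol_def)
    then have "const_mpol (inverse c) * f = 1" unfolding c by (simp add: const_mpol_def mult_single)
    then show False using no_unit[OF that(1), of "const_mpol (inverse c)"] ideal_zero[OF I] by simp
  qed
  have "1 \<notin> I"
  proof
    assume "1 \<in> I"
    then have "0 * p - 1 \<in> I" using ideal_diff[OF I ideal_zero[OF I]] by fastforce
    then show False using no_unit[of p 0] pq by simp
  qed
  then have "p \<noteq> 0" using p[of 1] ideal_zero[OF I] by auto
  obtain k l where kl: "homogeneous k p" "homogeneous l q" using fs(2) pq by auto
  have k: "k \<ge> 1" using pos[OF kl(1)] pq \<open>p \<noteq> 0\<close> by simp
  show thesis
  proof (cases "q = 0")
    case True
    have "homogeneous 1 q" by (simp add: True)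
    then show thesis using that[OF kl(1) _ k _ p q] by simp
  next
    case False
    then have "l \<ge> 1" using pos[OF kl(2)] pq by simp
    then show thesis using that[OF kl k _ p q] by simp
  qed
qed

lemma set_add_principal:
  "I <+>\<^bsub>\<A>\<^esub> PIdl\<^bsub>\<A>\<^esub> h = {f. \<exists>a. f - h * a \<in> I}"
proof -
  have "f \<in> I <+>\<^bsub>\<A>\<^esub> PIdl\<^bsub>\<A>\<^esub> h \<longleftrightarrow> (\<exists>g\<in>I. \<exists>a. f = g + h * a)" for f
    by (auto simp: set_add_def' cgenideal_def mult.commute)
  moreover have "f = g + h * a \<longleftrightarrow> g = f - h * a" for f g a by auto
  ultimately show ?thesis by auto
qed

lemma ideal_set_add_principal:
  assumes "ideal I \<A>"
  shows "ideal {f. \<exists>a. f - h * a \<in> I} \<A>"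
proof -
  interpret cring \<A> by (rule poly_ring_cring)
  show ?thesis
    using add_ideals[OF assms cgenideal_ideal[of h]] unfolding set_add_principal by simp
qed

text \<open>If \<open>p\<^sup>N f\<close> and \<open>q\<^sup>N f\<close> are \<open>h a\<close> and \<open>h b\<close> modulo \<open>I\<close>, then \<open>q\<^sup>N a \<equiv> p\<^sup>N b\<close>, so that
  \<open>p\<^sup>N\<close> divides \<open>a\<close>.\<close>

lemma scheme_inter_hypersurface:
  assumes I: "ideal I \<A>" and "ACM I m" "m \<ge> 1" and h: "cuts_properly h I"
  shows "scheme_inter I (PIdl\<^bsub>\<A>\<^esub> h) = {f. \<exists>a. f - h * a \<in> I}" (is "_ = ?J")
proof -
  have J: "ideal ?J \<A>" by (rule ideal_set_add_principal[OF I])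
  have h: "a \<in> I" if "h * a \<in> I" for a using h that by (simp add: cuts_properly_iff[OF I])
  obtain p q k l where pq: "homogeneous k p" "homogeneous l q" "k \<ge> 1" "l \<ge> 1"
    and p: "\<And>a. p * a \<in> I \<Longrightarrow> a \<in> I" and q: "\<And>a b. q * a - p * b \<in> I \<Longrightarrow> \<exists>c. a - p * c \<in> I"
    using ACM_regular_pair[OF assms(1-3)] by metis
  have pN: "a \<in> I" if "p ^ N * a \<in> I" for a N
    using that by (induction N) (auto simp: mult.assoc intro: p)
  have qN: "\<exists>c. a - p ^ N * c \<in> I" if "q * a - p ^ N * b \<in> I" for a b N
    by (rule regular_sequence_power_left[where q = q, OF I p q that])
  have "f \<in> ?J" if f: "f \<in> saturation ?J" for f
  proof -
    obtain N where N: "\<And>g. homogeneous (int N) g \<Longrightarrow> g * f \<in> ?J"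
      using f unfolding saturation_def by blast
    have "p ^ N * f \<in> ?J"
      using homogeneous_mult_in_ideal[OF J N homogeneous_power[OF pq(1), of N]] pq(3)
      by (simp add: mult_le_cancel_left1)
    then obtain a where a: "p ^ N * f - h * a \<in> I" by auto
    have "q ^ N * f \<in> ?J"
      using homogeneous_mult_in_ideal[OF J N homogeneous_power[OF pq(2), of N]] pq(4)
      by (simp add: mult_le_cancel_left1)
    then obtain b where b: "q ^ N * f - h * b \<in> I" by auto
    have "h * (q ^ N * a - p ^ N * b) =
        p ^ N * (q ^ N * f - h * b) - q ^ N * (p ^ N * f - h * a)"
      by (simp add: algebra_simps)
    then have "h * (q ^ N * a - p ^ N * b) \<in> I"
      using ideal_diff[OF I ideal_mult[OF I b] ideal_mult[OF I a]] by simp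
    then have "q ^ N * a - p ^ N * b \<in> I" by (rule h)
    then have "\<exists>c. a - p ^ N * c \<in> I" 
      using regular_sequence_power_right[where q = q and p = "p ^ N" and M = N and b = b] qN I by blast
    then obtain c where c: "a - p ^ N * c \<in> I" by blast
    have "p ^ N * (f - h * c) = (p ^ N * f - h * a) + h * (a - p ^ N * c)"
      by (simp add: algebra_simps)
    then have "p ^ N * (f - h * c) \<in> I"
      using ideal_add[OF I a ideal_mult[OF I c]] by simp
    then show "f \<in> ?J" using pN by blast
  qed
  moreover have "?J \<subseteq> saturation ?J"
    unfolding saturation_def using ideal_mult[OF J] by blast
  ultimately show ?thesis unfolding scheme_inter_def set_add_principal by auto
qed

lemma mult_mem_ideal_Hom:
  assumes "ideal V \<A>" "\<And>v. v \<in> V \<Longrightarrow> a * v \<in> Z"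
  shows "(\<lambda>v\<in>V. a * v) \<in> ideal_Hom V Z"
  unfolding ideal_Hom_def
  using assms(2) ideal_add[OF assms(1)] ideal_mult[OF assms(1)]
  by (auto simp: distrib_left mult.left_commute)

lemma linked_hypersurface_section:
  assumes I: "ideal I \<A>" "ideal IY \<A>" "I \<subseteq> IY"
    and h: "cuts_properly h I"
    and link: "linked {f. \<exists>a. f - h * a \<in> I} IY IY'"
  shows "f \<in> IY' \<longleftrightarrow> (\<exists>a\<in>IY. f - h * a \<in> I)"
proof -
  let ?V = "{f. \<exists>a. f - h * a \<in> I}"
  have V: "ideal ?V \<A>" by (rule ideal_set_add_principal[OF I(1)])
  have Z: "IY' = ?V \<inter> IY" and surj: "(\<lambda>g. \<lambda>f\<in>?V. g * f) ` IY = ideal_Hom ?V IY'"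
    using link unfolding linked_def bij_betw_def by auto
  have hV: "h \<in> ?V" using ideal_zero[OF I(1)] by (auto intro!: exI[of _ 1])
  show ?thesis
  proof
    assume "\<exists>a\<in>IY. f - h * a \<in> I"
    then obtain a where a: "a \<in> IY" "f - h * a \<in> I" by blast
    then have "(f - h * a) + h * a \<in> IY"
      using I(3) by (intro ideal_add[OF I(2)] ideal_mult[OF I(2)]) auto
    then show "f \<in> IY'" using a Z by auto
  next
    assume f: "f \<in> IY'"
    then obtain a where a: "f - h * a \<in> I" using Z by blast
    have "a * v \<in> IY'" if v: "v \<in> ?V" for v
    proof -
      obtain b where b: "v - h * b \<in> I" using v by blast
      have "a * v = a * (v - h * b) - b * (f - h * a) + b * f" by (simp add: algebra_simps)
      moreover have "a * (v - h * b) - b * (f - h * a) \<in> I"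
        by (intro ideal_diff[OF I(1)] ideal_mult[OF I(1)] a b)
      moreover have "b * f \<in> IY" using f Z by (intro ideal_mult[OF I(2)]) auto
      ultimately have "a * v \<in> IY" using ideal_add[OF I(2)] I(3) by auto
      then show ?thesis using ideal_mult[OF V v] Z by blast
    qed
    then have "(\<lambda>v\<in>?V. a * v) \<in> ideal_Hom ?V IY'"
      by (rule mult_mem_ideal_Hom[OF V])
    then obtain g where g: "g \<in> IY" "(\<lambda>v\<in>?V. a * v) = (\<lambda>v\<in>?V. g * v)"
      unfolding surj[symmetric] by auto
    have "a * h = g * h" using fun_cong[OF g(2), of h] hV by simp
    then have "h * (a - g) \<in> I" using ideal_zero[OF I(1)] by (simp add: algebra_simps)
    then have "a - g \<in> IY" using h I(3) by (auto simp: cuts_properly_iff[OF I(1)])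
    then have "a \<in> IY" using ideal_add[OF I(2) _ g(1)] by fastforce
    then show "\<exists>a\<in>IY. f - h * a \<in> I" using a by blast
  qed
qed

subsection \<open>Graded isomorphisms\<close>

lemma graded_isoE:
  assumes "graded_iso R M N"
  obtains f where "bij_betw f (carrier M) (carrier N)"
    "\<And>x y. x \<in> carrier M \<Longrightarrow> y \<in> carrier M \<Longrightarrow> f (x \<oplus>\<^bsub>M\<^esub> y) = f x \<oplus>\<^bsub>N\<^esub> f y"
    "\<And>r x. r \<in> carrier R \<Longrightarrow> x \<in> carrier M \<Longrightarrow> f (r \<odot>\<^bsub>M\<^esub> x) = r \<odot>\<^bsub>N\<^esub> f x"
    "\<And>l. f ` component M l = component N l"
  using assms unfolding graded_iso_def
proof (elim exE conjE)
  fix f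
  assume f: "bij_betw f (carrier M) (carrier N)"
    "\<forall>x\<in>carrier M. \<forall>y\<in>carrier M. f (x \<oplus>\<^bsub>M\<^esub> y) = f x \<oplus>\<^bsub>N\<^esub> f y"
    "\<forall>r\<in>carrier R. \<forall>x\<in>carrier M. f (r \<odot>\<^bsub>M\<^esub> x) = r \<odot>\<^bsub>N\<^esub> f x"
    "\<forall>l. f ` component M l = component N l"
  show thesis
    by (rule that[OF f(1)]) (simp_all add: f(2-4))
qed

lemma graded_iso_trans:
  assumes "graded_iso R M N" "graded_iso R N P"
  shows "graded_iso R M P"
proof -
  obtain f where f: "bij_betw f (carrier M) (carrier N)"
    "\<And>x y. x \<in> carrier M \<Longrightarrow> y \<in> carrier M \<Longrightarrow> f (x \<oplus>\<^bsub>M\<^esub> y) = f x \<oplus>\<^bsub>N\<^esub> f y"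
    "\<And>r x. r \<in> carrier R \<Longrightarrow> x \<in> carrier M \<Longrightarrow> f (r \<odot>\<^bsub>M\<^esub> x) = r \<odot>\<^bsub>N\<^esub> f x"
    "\<And>l. f ` component M l = component N l"
    by (fact graded_isoE[OF assms(1)])
  obtain g where g: "bij_betw g (carrier N) (carrier P)"
    "\<And>x y. x \<in> carrier N \<Longrightarrow> y \<in> carrier N \<Longrightarrow> g (x \<oplus>\<^bsub>N\<^esub> y) = g x \<oplus>\<^bsub>P\<^esub> g y"
    "\<And>r x. r \<in> carrier R \<Longrightarrow> x \<in> carrier N \<Longrightarrow> g (r \<odot>\<^bsub>N\<^esub> x) = r \<odot>\<^bsub>P\<^esub> g x"
    "\<And>l. g ` component N l = component P l"
    by (fact graded_isoE[OF assms(2)])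
  have "f x \<in> carrier N" if "x \<in> carrier M" for x using bij_betwE[OF f(1)] that by blast
  moreover have "(g \<circ> f) ` component M l = component P l" for l
    by (simp only: image_comp[symmetric] f(4) g(4))
  ultimately show ?thesis
    unfolding graded_iso_def
    using bij_betw_trans[OF f(1) g(1)]
    by (intro exI[of _ "g \<circ> f"]) (simp add: f(2,3) g(2,3))
qed

lemma graded_iso_sym:
  assumes "graded_iso R M N"
    and add: "\<And>x y. x \<in> carrier M \<Longrightarrow> y \<in> carrier M \<Longrightarrow> x \<oplus>\<^bsub>M\<^esub> y \<in> carrier M"
    and smult: "\<And>r x. r \<in> carrier R \<Longrightarrow> x \<in> carrier M \<Longrightarrow> r \<odot>\<^bsub>M\<^esub> x \<in> carrier M"
    and comp: "\<And>l. component M l \<subseteq> carrier M"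
  shows "graded_iso R N M"
proof -
  obtain f where f: "bij_betw f (carrier M) (carrier N)"
    "\<And>x y. x \<in> carrier M \<Longrightarrow> y \<in> carrier M \<Longrightarrow> f (x \<oplus>\<^bsub>M\<^esub> y) = f x \<oplus>\<^bsub>N\<^esub> f y"
    "\<And>r x. r \<in> carrier R \<Longrightarrow> x \<in> carrier M \<Longrightarrow> f (r \<odot>\<^bsub>M\<^esub> x) = r \<odot>\<^bsub>N\<^esub> f x"
    "\<And>l. f ` component M l = component N l"
    by (fact graded_isoE[OF assms(1)])
  define g where "g = inv_into (carrier M) f"
  have g: "g (f x) = x" if "x \<in> carrier M" for x
    using f(1) that by (simp add: g_def bij_betw_def)
  have N: "\<exists>x\<in>carrier M. y = f x" if "y \<in> carrier N" for y
    using f(1) that by (auto simp: bij_betw_def)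
  have "g (x \<oplus>\<^bsub>N\<^esub> y) = g x \<oplus>\<^bsub>M\<^esub> g y" if xy: "x \<in> carrier N" "y \<in> carrier N" for x y
  proof -
    obtain u v where "u \<in> carrier M" "v \<in> carrier M" "x = f u" "y = f v" using N xy by metis
    then show ?thesis using f(2)[of u v] add[of u v] by (simp add: g flip: f(2))
  qed
  moreover have "g (r \<odot>\<^bsub>N\<^esub> x) = r \<odot>\<^bsub>M\<^esub> g x" if rx: "r \<in> carrier R" "x \<in> carrier N" for r x
  proof -
    obtain u where "u \<in> carrier M" "x = f u" using N rx by metis
    then show ?thesis using smult[of r u] rx by (simp add: g flip: f(3))
  qed
  moreover have "g ` component N l = component M l" for l
    unfolding f(4)[symmetric] image_image using comp[of l] g by (force simp: image_iff)
  moreover have "bij_betw g (carrier N) (carrier M)"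
    unfolding g_def by (rule bij_betw_inv_into[OF f(1)])
  ultimately show ?thesis unfolding graded_iso_def by blast
qed

lemma graded_iso_shift: "graded_iso R M N \<Longrightarrow> graded_iso R (shift M a) (shift N a)"
  unfolding graded_iso_def shift_def by (erule ex_forward) simp

lemma shift_direct_sum: "shift (direct_sum d M) a = direct_sum d (\<lambda>i. shift (M i) a)"
  by (simp add: shift_def direct_sum_def)

lemma shift_shift: "shift (shift M a) b = shift M (a + b)"
  by (simp add: shift_def add.assoc)

text \<open>Let \<open>P\<close> and \<open>Q\<close> be the matrices of constant terms of a graded isomorphism of free modules and
  of its inverse.  They are inverse to each other, and homogeneity makes \<open>P j i\<close> and \<open>Q i j\<close> vanish
  unless the \<open>i\<close>-th and \<open>j\<close>-th generators have equal degree.  The trace of \<open>Q P\<close> over the generators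
  of degree \<open>l\<close> is thus the trace of \<open>P Q\<close> over those of the other module.\<close>

lemma graded_iso_direct_sum_card:
  fixes L :: "nat \<Rightarrow> ('v::finite, 'k::field_char_0) mpol" and n n' :: "nat \<Rightarrow> int" and m d :: nat
  defines "F \<equiv> \<lambda>n. direct_sum d (\<lambda>i. shift (param_ring_module m L) (- n i))"
  assumes iso: "graded_iso (param_ring m L) (F n) (F n')"
  shows "card {i\<in>{..<d}. n i = l} = card {i\<in>{..<d}. n' i = l}"
proof -
  define R where "R = carrier (param_ring m L)"
  define e :: "nat \<Rightarrow> nat \<Rightarrow> ('v, 'k) mpol" where
    "e i = (\<lambda>j\<in>{..<d}. if j = i then 1 else 0)" for i
  interpret A: cring \<A> by (rule poly_ring_cring)
  have "subring R \<A>"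
    unfolding R_def param_ring_def using A.generate_ring_is_subring by simp
  then have sub: "0 \<in> R" "1 \<in> R"
    "\<And>a b. a \<in> R \<Longrightarrow> b \<in> R \<Longrightarrow> a + b \<in> R" "\<And>a b. a \<in> R \<Longrightarrow> b \<in> R \<Longrightarrow> a * b \<in> R"
    using subringE(2,3,6,7)[of R \<A>] by simp_all
  have F: "carrier (F n) = (\<Pi>\<^sub>E i\<in>{..<d}. R)"
    "add (F n) = (\<lambda>u v. \<lambda>i\<in>{..<d}. u i + v i)"
    "smult (F n) = (\<lambda>r u. \<lambda>i\<in>{..<d}. r * u i)"
    "component (F n) = (\<lambda>l. \<Pi>\<^sub>E i\<in>{..<d}. {f\<in>R. homogeneous (l - n i) f})" for n
    by (simp_all add: F_def direct_sum_def shift_def param_ring_module_def R_def)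
  have expand: "f x j = (\<Sum>i<d. x i * f (e i) j)"
    if add: "\<And>x y. x \<in> carrier (F n) \<Longrightarrow> y \<in> carrier (F n) \<Longrightarrow> f (x \<oplus>\<^bsub>F n\<^esub> y) = f x \<oplus>\<^bsub>F n'\<^esub> f y"
      and smult: "\<And>r x. r \<in> R \<Longrightarrow> x \<in> carrier (F n) \<Longrightarrow> f (r \<odot>\<^bsub>F n\<^esub> x) = r \<odot>\<^bsub>F n'\<^esub> f x"
      and x: "x \<in> carrier (F n)" and j: "j < d" for f x j n n'
  proof -
    define t where "t k = (\<lambda>i\<in>{..<d}. if i < k then x i else 0)" for k
    have t: "t k \<in> carrier (F n)" for k
      unfolding t_def F(1) using x[unfolded F(1)] sub(1) by (simp add: PiE_iff)
    have e: "e k \<in> carrier (F n)" for k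
      unfolding e_def F(1) using sub(1,2) by simp
    have "f (t k) j = (\<Sum>i<k. x i * f (e i) j)" if "k \<le> d" for k
      using that
    proof (induction k)
      case 0
      have "t 0 \<oplus>\<^bsub>F n\<^esub> t 0 = t 0" by (auto simp: t_def F)
      then have "f (t 0) = f (t 0) \<oplus>\<^bsub>F n'\<^esub> f (t 0)" using add[OF t t, of 0 0] by simp
      from fun_cong[OF this, of j] show ?case using j by (simp add: F(2))
    next
      case (Suc k)
      have xk: "x k \<in> R" using PiE_mem[OF x[unfolded F(1)]] Suc.prems by simp
      then have ek: "x k \<odot>\<^bsub>F n\<^esub> e k \<in> carrier (F n)" 
        unfolding F(1,3) using e[of k, unfolded F(1)] sub(4) by (simp add: PiE_iff)
      have "t (Suc k) = t k \<oplus>\<^bsub>F n\<^esub> (x k \<odot>\<^bsub>F n\<^esub> e k)"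
        by (auto simp: t_def e_def F less_Suc_eq)
      then have "f (t (Suc k)) = f (t k) \<oplus>\<^bsub>F n'\<^esub> (x k \<odot>\<^bsub>F n'\<^esub> f (e k))"
        using add[OF t ek] smult[OF xk e] by simp
      from fun_cong[OF this, of j] have "f (t (Suc k)) j = f (t k) j + x k * f (e k) j"
        using j by (simp add: F(2,3))
      then show ?case using Suc by simp
    qed
    moreover have "t d = x" using x by (auto simp: t_def F fun_eq_iff PiE_def extensional_def)
    ultimately show ?thesis by (metis order_refl)
  qed
  obtain f where f: "bij_betw f (carrier (F n)) (carrier (F n'))"
    and f_lin: "\<And>x y. x \<in> carrier (F n) \<Longrightarrow> y \<in> carrier (F n) \<Longrightarrow> f (x \<oplus>\<^bsub>F n\<^esub> y) = f x \<oplus>\<^bsub>F n'\<^esub> f y"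
    "\<And>r x. r \<in> R \<Longrightarrow> x \<in> carrier (F n) \<Longrightarrow> f (r \<odot>\<^bsub>F n\<^esub> x) = r \<odot>\<^bsub>F n'\<^esub> f x"
    and f_comp: "\<And>l. f ` component (F n) l = component (F n') l"
    unfolding R_def by (fact graded_isoE[OF iso])
  define g where "g = inv_into (carrier (F n)) f"
  have g: "g (f x) = x" if "x \<in> carrier (F n)" for x
    using f that by (simp add: g_def bij_betw_def)
  have fg: "f (g y) = y" "g y \<in> carrier (F n)" if "y \<in> carrier (F n')" for y
    using f that by (auto simp: g_def bij_betw_def f_inv_into_f inv_into_into)
  have f_closed: "f x \<in> carrier (F n')" if "x \<in> carrier (F n)" for x
    using bij_betwE[OF f] that by blast
  have closed: "x \<oplus>\<^bsub>F n\<^esub> y \<in> carrier (F n)" "r \<in> R \<Longrightarrow> r \<odot>\<^bsub>F n\<^esub> x \<in> carrier (F n)"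
    if "x \<in> carrier (F n)" "y \<in> carrier (F n)" for x y r
    using that sub(3,4) by (auto simp: F PiE_iff)
  have g_lin: "g (x \<oplus>\<^bsub>F n'\<^esub> y) = g x \<oplus>\<^bsub>F n\<^esub> g y" if "x \<in> carrier (F n')" "y \<in> carrier (F n')" for x y
    using f_lin(1)[of "g x" "g y"] fg that g closed by metis
  have g_smult: "g (r \<odot>\<^bsub>F n'\<^esub> x) = r \<odot>\<^bsub>F n\<^esub> g x" if "r \<in> R" "x \<in> carrier (F n')" for x r
    using f_lin(2)[of r "g x"] fg that g closed by metis
  have e: "e i \<in> carrier (F n)" "e i \<in> component (F n) (n i)" for i n
    using sub(1,2) by (simp_all add: e_def F homogeneous_one)
  have comp_closed: "component (F n) l \<subseteq> carrier (F n)" for l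
    by (auto simp: F PiE_def)
  have g_comp: "g y \<in> component (F n) l" if y: "y \<in> component (F n') l" for y l
  proof -
    obtain x where "x \<in> component (F n) l" "y = f x" using y unfolding f_comp[symmetric] by blast
    then show ?thesis using g subsetD[OF comp_closed] by simp
  qed
  define w where "w i j = Poly_Mapping.lookup (g (e j) i) 0 * Poly_Mapping.lookup (f (e i) j) 0" for i j
  have w_zero: "w i j = 0" if ij: "i < d" "j < d" "n i \<noteq> n' j" for i j
  proof -
    have "f (e i) \<in> component (F n') (n i)" using f_comp e by blast
    then have "homogeneous (n i - n' j) (f (e i) j)" using ij by (auto simp: F)
    then have "Poly_Mapping.lookup (f (e i) j) 0 = 0" using ij by (auto simp: homogeneous_iff)
    then show ?thesis by (simp add: w_def)
  qed
  then have w_support: "w i j \<noteq> 0 \<Longrightarrow> i < d \<Longrightarrow> j < d \<Longrightarrow> n i = n' j" for i j by blast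
  have col: "(\<Sum>i<d. w i j) = 1" if j: "j < d" for j
  proof -
    have "(1::('v, 'k) mpol) = f (g (e j)) j" using fg(1)[OF e(1)] j by (simp add: e_def)
    also have "\<dots> = (\<Sum>i<d. g (e j) i * f (e i) j)"
      by (rule expand[OF f_lin fg(2)[OF e(1)] j])
    finally have "1 = (\<Sum>i<d. g (e j) i * f (e i) j)" .
    from arg_cong[OF this, of "\<lambda>p. Poly_Mapping.lookup p 0"]
    show ?thesis by (simp add: lookup_sum lookup_mult_zero w_def)
  qed
  have row: "(\<Sum>j<d. w i j) = 1" if i: "i < d" for i
  proof -
    have "(1::('v, 'k) mpol) = g (f (e i)) i" using g[OF e(1)] i by (simp add: e_def)
    also have "\<dots> = (\<Sum>j<d. f (e i) j * g (e j) i)"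
      by (rule expand[OF g_lin g_smult f_closed[OF e(1)] i])
    finally have "1 = (\<Sum>j<d. f (e i) j * g (e j) i)" .
    from arg_cong[OF this, of "\<lambda>p. Poly_Mapping.lookup p 0"]
    show ?thesis by (simp add: lookup_sum lookup_mult_zero w_def mult.commute)
  qed
  let ?S = "{i\<in>{..<d}. n i = l}" and ?T = "{j\<in>{..<d}. n' j = l}"
  have "of_nat (card ?S) = (\<Sum>i\<in>?S. \<Sum>j<d. w i j)" using row by simp
  also have "\<dots> = (\<Sum>i\<in>?S. \<Sum>j\<in>?T. w i j)"
    by (rule sum.cong[OF refl], rule sum.mono_neutral_right) (auto dest: w_support)
  also have "\<dots> = (\<Sum>j\<in>?T. \<Sum>i\<in>?S. w i j)" by (rule sum.swap)
  also have "\<dots> = (\<Sum>j\<in>?T. \<Sum>i<d. w i j)"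
    by (rule sum.cong[OF refl], rule sum.mono_neutral_left) (auto dest: w_support)
  also have "\<dots> = of_nat (card ?T)" using col by simp
  finally show ?thesis by simp
qed

lemma mono_on_eq_if_card_eq:
  fixes n n' :: "nat \<Rightarrow> 'a::linorder"
  assumes mono: "mono_on {..<d} n" "mono_on {..<d} n'"
    and card: "\<And>l. card {i\<in>{..<d}. n i = l} = card {i\<in>{..<d}. n' i = l}"
    and i: "i < d"
  shows "n i = n' i"
proof -
  have count: "count (mset (map n [0..<d])) l = card {i\<in>{..<d}. n i = l}" for n :: "nat \<Rightarrow> 'a" and l
    by (simp add: count_image_mset vimage_def Int_def conj_commute atLeast0LessThan lessThan_def)
  have sorted: "sorted (map n [0..<d])" if "mono_on {..<d} n" for n :: "nat \<Rightarrow> 'a"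
    using that by (auto simp: sorted_iff_nth_mono mono_on_def)
  have "mset (map n [0..<d]) = mset (map n' [0..<d])"
    by (intro multiset_eqI) (simp only: count card)
  then have "map n [0..<d] = map n' [0..<d]"
    using sorted mono by (metis properties_for_sort)
  then show ?thesis using i by simp
qed

lemma relative_ideal_mult_graded_iso:
  assumes I: "homogeneous_ideal I" "homogeneous_ideal IY"
    and h: "homogeneous s h" "cuts_properly h I"
    and IY': "\<And>f. f \<in> IY' \<longleftrightarrow> (\<exists>a\<in>IY. f - h * a \<in> I)"
  shows "graded_iso R (relative_ideal I IY) (shift (relative_ideal I IY') s)"
proof -
  have id: "ideal I \<A>" "ideal IY \<A>" using I by (auto simp: homogeneous_ideal_def)
  let ?f = "\<lambda>x. residue_class I h \<otimes>\<^bsub>coord_ring I\<^esub> x"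
  have f: "?f (residue_class I a) = residue_class I (h * a)" for a
    by (rule coord_ring_mult[OF id(1)])
  have mem: "h * a \<in> IY'" if "a \<in> IY" for a
    using that IY' ideal_zero[OF id(1)] by force
  interpret Q: cring "coord_ring I" by (rule coord_ring_cring[OF id(1)])
  have Q: "residue_class I a \<in> carrier (coord_ring I)" for a by (simp add: coord_ring_carrier[OF id(1)])
  have im: "?f ` residue_class I ` IY = residue_class I ` IY'"
  proof
    show "?f ` residue_class I ` IY \<subseteq> residue_class I ` IY'" using mem by (auto simp: f)
    show "residue_class I ` IY' \<subseteq> ?f ` residue_class I ` IY"
    proof
      fix x assume "x \<in> residue_class I ` IY'"
      then obtain g where g: "g \<in> IY'" "x = residue_class I g" by blast
      then obtain a where a: "a \<in> IY" "g - h * a \<in> I" using IY' by blast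
      then have "x = ?f (residue_class I a)" by (simp add: f g residue_class_eq_iff[OF id(1)])
      then show "x \<in> ?f ` residue_class I ` IY" using a by blast
    qed
  qed
  have inj: "inj_on ?f (residue_class I ` IY)"
    using h(2) unfolding cuts_properly_def
    by (rule inj_on_subset) (auto simp: coord_ring_carrier[OF id(1)])
  have comp: "?f ` residue_class I ` {f\<in>IY. homogeneous l f} =
      residue_class I ` {f\<in>IY'. homogeneous (s + l) f}" for l
  proof
    show "?f ` residue_class I ` {f\<in>IY. homogeneous l f} \<subseteq>
        residue_class I ` {f\<in>IY'. homogeneous (s + l) f}"
      using mem homogeneous_mult[OF h(1)] by (auto simp: f)
    show "residue_class I ` {f\<in>IY'. homogeneous (s + l) f} \<subseteq>
        ?f ` residue_class I ` {f\<in>IY. homogeneous l f}"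
    proof
      fix x assume "x \<in> residue_class I ` {f\<in>IY'. homogeneous (s + l) f}"
      then obtain g where g: "g \<in> IY'" "homogeneous (s + l) g" "x = residue_class I g" by blast
      then obtain a where a: "a \<in> IY" "g - h * a \<in> I" using IY' by blast
      have "hom_part (l + s) g = hom_part (l + s) (g - h * a) + hom_part (l + s) (h * a)"
        by (simp flip: hom_part_add)
      then have "g = hom_part (l + s) (g - h * a) + h * hom_part l a"
        using g(2) by (simp add: hom_part_homogeneous hom_part_homogeneous_mult[OF h(1)] add.commute[of s])
      then have "g - h * hom_part l a = hom_part (l + s) (g - h * a)" by (subst diff_eq_eq)
      then have "g - h * hom_part l a \<in> I" using I(1) a(2) by (simp add: homogeneous_ideal_def)
      then have "x = ?f (residue_class I (hom_part l a))"
        by (simp add: f g residue_class_eq_iff[OF id(1)])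
      moreover have "hom_part l a \<in> IY" using I(2) a(1) by (simp add: homogeneous_ideal_def)
      ultimately show "x \<in> ?f ` residue_class I ` {f\<in>IY. homogeneous l f}"
        using homogeneous_hom_part[of l a] by blast
    qed
  qed
  show ?thesis
    unfolding graded_iso_def
  proof (intro exI[of _ ?f] conjI ballI allI)
    show "bij_betw ?f (carrier (relative_ideal I IY)) (carrier (shift (relative_ideal I IY') s))"
      using im inj by (simp add: relative_ideal_def shift_def bij_betw_def)
  next
    fix x y assume "x \<in> carrier (relative_ideal I IY)" "y \<in> carrier (relative_ideal I IY)"
    then show "?f (x \<oplus>\<^bsub>relative_ideal I IY\<^esub> y) = ?f x \<oplus>\<^bsub>shift (relative_ideal I IY') s\<^esub> ?f y"
      using Q by (auto simp: relative_ideal_def shift_def Q.r_distr)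
  next
    fix r x assume "x \<in> carrier (relative_ideal I IY)"
    then show "?f (r \<odot>\<^bsub>relative_ideal I IY\<^esub> x) = r \<odot>\<^bsub>shift (relative_ideal I IY') s\<^esub> ?f x"
      using Q by (auto simp: relative_ideal_def shift_def Q.m_lcomm)
  next
    fix l
    show "?f ` component (relative_ideal I IY) l = component (shift (relative_ideal I IY') s) l"
      using comp by (simp add: relative_ideal_def shift_def)
  qed
qed

lemma relative_ideal_closed:
  assumes "ideal I \<A>" "ideal IY \<A>"
  shows "x \<in> carrier (relative_ideal I IY) \<Longrightarrow> y \<in> carrier (relative_ideal I IY) \<Longrightarrow>
      x \<oplus>\<^bsub>relative_ideal I IY\<^esub> y \<in> carrier (relative_ideal I IY)"
    and "x \<in> carrier (relative_ideal I IY) \<Longrightarrow> r \<odot>\<^bsub>relative_ideal I IY\<^esub> x \<in> carrier (relative_ideal I IY)"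
    and "component (relative_ideal I IY) l \<subseteq> carrier (relative_ideal I IY)"
  by (auto simp: relative_ideal_def coord_ring_add[OF assms(1)] coord_ring_mult[OF assms(1)]
      intro!: imageI ideal_add[OF assms(2)] ideal_mult[OF assms(2)])

theorem proposition1:
  fixes IX IY IY' :: "('v::finite, 'k::{alg_closed_field, field_char_0}) mpol set"
    and L :: "nat \<Rightarrow> ('v, 'k) mpol" and h :: "('v, 'k) mpol"
    and m d s :: nat and n n' :: "nat \<Rightarrow> int"
  assumes "m \<ge> 1"
    and "projective_subscheme IX" and "ACM IX m" and "pure_dimension IX m" and "has_degree IX d"
    and "linear_system_of_parameters IX m L"
    and "hypersurface_form h s" and "cuts_properly h IX"
    and "ACM_hypersurface IX m IY" and "relative_char_seq m L IX IY d n"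
    and "ACM_hypersurface IX m IY'" and "relative_char_seq m L IX IY' d n'"
    and "linked (scheme_inter IX (PIdl\<^bsub>\<A>\<^esub> h)) IY IY'"
  shows "\<forall>i<d. n' i = n i + int s"
proof -
  let ?P = "param_ring m L" and ?M = "param_ring_module m L"
  have IX: "homogeneous_ideal IX" and IY: "homogeneous_ideal IY" and sub: "IX \<subseteq> IY"
    using assms(2,9) by (auto simp: projective_subscheme_def ACM_hypersurface_def)
  then have id: "ideal IX \<A>" "ideal IY \<A>" by (auto simp: homogeneous_ideal_def)
  have h: "homogeneous (int s) h" using assms(7) by (simp add: hypersurface_form_def)
  have "linked {f. \<exists>a. f - h * a \<in> IX} IY IY'"
    using assms(13) unfolding scheme_inter_hypersurface[OF id(1) assms(3,1,8)] .
  note IY' = linked_hypersurface_section[OF id sub assms(8) this]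
  have n: "graded_iso ?P (relative_ideal IX IY) (direct_sum d (\<lambda>i. shift ?M (- n i)))"
    and n': "graded_iso ?P (relative_ideal IX IY') (direct_sum d (\<lambda>i. shift ?M (- n' i)))"
    and mono: "mono_on {..<d} n" "mono_on {..<d} n'"
    using assms(10,12) by (simp_all add: relative_char_seq_def)
  have "graded_iso ?P (direct_sum d (\<lambda>i. shift ?M (- n i))) (relative_ideal IX IY)"
    by (rule graded_iso_sym[OF n]) (rule relative_ideal_closed[OF id]; assumption)+
  moreover have "graded_iso ?P (relative_ideal IX IY) (shift (relative_ideal IX IY') (int s))"
    by (rule relative_ideal_mult_graded_iso[OF IX IY h assms(8) IY'])
  moreover have "graded_iso ?P (shift (relative_ideal IX IY') (int s))
      (direct_sum d (\<lambda>i. shift ?M (- (n' i - int s))))"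
    using graded_iso_shift[OF n', of "int s"] by (simp add: shift_direct_sum shift_shift)
  ultimately have "graded_iso ?P (direct_sum d (\<lambda>i. shift ?M (- n i)))
      (direct_sum d (\<lambda>i. shift ?M (- (n' i - int s))))"
    by (rule graded_iso_trans[OF graded_iso_trans])
  note card = graded_iso_direct_sum_card[OF this]
  have "mono_on {..<d} (\<lambda>i. n' i - int s)" using mono(2) by (simp add: mono_on_def)
  from mono_on_eq_if_card_eq[OF mono(1) this card] show ?thesis by (simp add: algebra_simps)
qed

end
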